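(* For every positive integer $p$, $$\frac{1}{p}-\frac{1}{2p+1}<Q_p<\frac{1}{2p}+\frac{3}{8p^2}<1 .$$
   Context: For a positive integer $p$, $$Q_p=2p^2\zeta(3,p)-p\,\zeta(2,p),$$ where $\zeta(2,p)=\sum_{k=p}^\infty \frac{1}{k^2}$ and $\zeta(3,p)=\sum_{k=p}^\infty\frac{1}{k^3}$ are Hurwitz zeta values. *)

theory Defs
  imports "HOL-Analysis.Analysis"
begin

text \<open>Hurwitz zeta values at integer arguments. The series converges absolutely for
  \<open>s \<ge> 2\<close>; outside this range \<^const>\<open>infsum\<close> returns the junk value 0.\<close>

definition hurwitz_zeta :: "nat \<Rightarrow> nat \<Rightarrow> real" where
  "hurwitz_zeta s p = (\<Sum>\<^sub>\<infinity>k\<in>{p..}. 1 / real k ^ s)"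

lemma summable_on_hurwitz_zeta:
  assumes "2 \<le> s"
  shows "(\<lambda>k. 1 / real k ^ s) summable_on {p..}"
proof -
  have "summable (\<lambda>k. norm (1 / real k ^ s))"
    using inverse_power_summable[OF assms, where 'a = real] by (simp add: inverse_eq_divide)
  then have "(\<lambda>k. 1 / real k ^ s) summable_on UNIV"
    by (rule norm_summable_imp_summable_on)
  then show ?thesis
    by (rule summable_on_subset_banach) simp
qed

definition Q :: "nat \<Rightarrow> real" where
  "Q p = 2 * (real p)\<^sup>2 * hurwitz_zeta 3 p - real p * hurwitz_zeta 2 p"

end

theory Submission
  imports Defs "HOL-Real_Asymp.Real_Asymp"
begin

text \<open>
  The Euler--Maclaurin expansions at \<open>x = p\<close> begin
  \[ \zeta(2,x) \sim \frac1x + \frac1{2x^2} + \frac1{6x^3} - \cdots, \qquad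
     \zeta(3,x) \sim \frac1{2x^2} + \frac1{2x^3} + \frac1{4x^4} - \frac1{12x^6} + \cdots, \]
  so that \<open>Q p\<close> is \<open>1/(2p) + 1/(3p\<^sup>2) + O(1/p\<^sup>4)\<close>. The upper bound \<open>1/(2p) + 3/(8p\<^sup>2)\<close>
  exceeds this at order \<open>1/p\<^sup>2\<close>, while the lower bound
  \<open>1/p - 1/(2p+1) = 1/(2p) + 1/(4p\<^sup>2) - \<dots>\<close> falls short of it. It therefore suffices to have
  short truncations of the two expansions, in one case with a lowered last coefficient, as genuine
  bounds for every \<open>p \<ge> 1\<close>.

  A function \<open>F\<close> that tends to 0 bounds \<open>\<zeta>(s,p)\<close> as soon as the difference \<open>F(x) - F(x+1)\<close>
  bounds \<open>1/x\<^sup>s\<close> from the same side: summing over \<open>x = p, p+1, \<dots>\<close> telescopes to \<open>F(p)\<close>.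
  For the four functions used here, the defect \<open>F(x) - F(x+1) - 1/x\<^sup>s\<close> is an explicit
  rational function of visibly constant sign on \<open>x \<ge> 1\<close>. What remains is a comparison of rational functions
  of \<open>p\<close>. That comparison is an equality for all \<open>p\<close> in the upper bound, and for \<open>p = 1\<close> in the
  lower one, so the strictness of the result comes from the zeta bounds.
\<close>

lemma sums_strict_mono:
  fixes f g :: "nat \<Rightarrow> real"
  assumes "f sums a" "g sums b" "\<And>n. f n < g n"
  shows "a < b"
proof -
  have "(\<lambda>n. g n - f n) sums (b - a)"
    using assms by (intro sums_diff)
  moreover have "0 < (\<Sum>n. g n - f n)"
    using assms calculation by (intro suminf_pos) (auto simp: sums_iff)
  ultimately show ?thesis
    by (simp add: sums_iff)
qed

lemma hurwitz_zeta_sums: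
  assumes "2 \<le> s"
  shows "(\<lambda>n. 1 / real (n + p) ^ s) sums hurwitz_zeta s p"
proof -
  have "((\<lambda>k. 1 / real k ^ s) has_sum hurwitz_zeta s p) {p..}"
    unfolding hurwitz_zeta_def by (intro has_sum_infsum summable_on_hurwitz_zeta assms)
  also have "?this \<longleftrightarrow> ((\<lambda>n. 1 / real (n + p) ^ s) has_sum hurwitz_zeta s p) UNIV"
    by (rule has_sum_reindex_bij_witness[where i = "\<lambda>n. n + p" and j = "\<lambda>k. k - p"]) auto
  finally show ?thesis
    by (rule has_sum_imp_sums)
qed

lemma telescope_sums_from:
  fixes F :: "real \<Rightarrow> real"
  assumes "(F \<longlongrightarrow> 0) at_top"
  shows "(\<lambda>n. F (real (n + p)) - F (real (n + p) + 1)) sums F (real p)"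
proof -
  have "(\<lambda>n. F (real (n + p))) \<longlonglongrightarrow> 0"
    by (rule filterlim_compose[OF assms]) real_asymp
  from telescope_sums'[OF this] show ?thesis
    by (simp add: algebra_simps)
qed

lemma hurwitz_zeta_less:
  fixes F :: "real \<Rightarrow> real"
  assumes "2 \<le> s" "p > 0" "(F \<longlongrightarrow> 0) at_top"
    and "\<And>x. x \<ge> 1 \<Longrightarrow> 1 / x ^ s < F x - F (x + 1)"
  shows "hurwitz_zeta s p < F (real p)"
  by (rule sums_strict_mono[OF hurwitz_zeta_sums telescope_sums_from]) (use assms in auto)

lemma hurwitz_zeta_greater:
  fixes F :: "real \<Rightarrow> real"
  assumes "2 \<le> s" "p > 0" "(F \<longlongrightarrow> 0) at_top"
    and "\<And>x. x \<ge> 1 \<Longrightarrow> F x - F (x + 1) < 1 / x ^ s"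
  shows "F (real p) < hurwitz_zeta s p"
  by (rule sums_strict_mono[OF telescope_sums_from hurwitz_zeta_sums]) (use assms in auto)

lemma hurwitz_zeta_2_less:
  assumes "p > 0"
  shows "hurwitz_zeta 2 p < 1 / real p + 1 / (2 * real p ^ 2) + 1 / (6 * real p ^ 3)"
proof -
  define F :: "real \<Rightarrow> real" where "F = (\<lambda>x. 1 / x + 1 / (2 * x ^ 2) + 1 / (6 * x ^ 3))"
  have "1 / x ^ 2 < F x - F (x + 1)" if "x \<ge> 1" for x
  proof -
    have "x \<noteq> 0" "x + 1 \<noteq> 0" using that by auto
    then have "F x - F (x + 1) - 1 / x ^ 2 = 1 / (6 * x ^ 3 * (x + 1) ^ 3)"
      unfolding F_def by (simp add: divide_simps) algebra
    moreover have "\<dots> > 0" using that by simp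
    ultimately show ?thesis by linarith
  qed
  moreover have "(F \<longlongrightarrow> 0) at_top" unfolding F_def by real_asymp
  ultimately have "hurwitz_zeta 2 p < F (real p)"
    using assms by (intro hurwitz_zeta_less) auto
  then show ?thesis by (simp add: F_def)
qed

text \<open>The coefficient \<open>1/6\<close> of the expansion overestimates \<open>\<zeta>(2,x)\<close> and has to be lowered;
  \<open>1/8\<close> is the value for which, with the upper bound on \<open>\<zeta>(3,p)\<close> below, the upper bound on \<open>Q p\<close> comes out exactly as \<open>1/(2p) + 3/(8p\<^sup>2)\<close>.\<close>

lemma hurwitz_zeta_2_greater:
  assumes "p > 0"
  shows "1 / real p + 1 / (2 * real p ^ 2) + 1 / (8 * real p ^ 3) < hurwitz_zeta 2 p"
proof -
  define F :: "real \<Rightarrow> real" where "F = (\<lambda>x. 1 / x + 1 / (2 * x ^ 2) + 1 / (8 * x ^ 3))"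
  have "F x - F (x + 1) < 1 / x ^ 2" if "x \<ge> 1" for x
  proof -
    have "x \<noteq> 0" "x + 1 \<noteq> 0" using that by auto
    then have "1 / x ^ 2 - (F x - F (x + 1)) = (x ^ 2 + x - 1) / (8 * x ^ 3 * (x + 1) ^ 3)"
      unfolding F_def by (simp add: divide_simps) algebra
    moreover have "\<dots> > 0"
    proof -
      have "x ^ 2 > 0" using that by simp
      then have "x ^ 2 + x - 1 > 0" using that by linarith
      then show ?thesis using that by simp
    qed
    ultimately show ?thesis by linarith
  qed
  moreover have "(F \<longlongrightarrow> 0) at_top" unfolding F_def by real_asymp
  ultimately have "F (real p) < hurwitz_zeta 2 p"
    using assms by (intro hurwitz_zeta_greater) auto
  then show ?thesis by (simp add: F_def)
qed

lemma hurwitz_zeta_3_less: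
  assumes "p > 0"
  shows "hurwitz_zeta 3 p < 1 / (2 * real p ^ 2) + 1 / (2 * real p ^ 3) + 1 / (4 * real p ^ 4)"
proof -
  define F :: "real \<Rightarrow> real" where
    "F = (\<lambda>x. 1 / (2 * x ^ 2) + 1 / (2 * x ^ 3) + 1 / (4 * x ^ 4))"
  have "1 / x ^ 3 < F x - F (x + 1)" if "x \<ge> 1" for x
  proof -
    have "x \<noteq> 0" "x + 1 \<noteq> 0" using that by auto
    then have "F x - F (x + 1) - 1 / x ^ 3 = (2 * x + 1) / (4 * x ^ 4 * (x + 1) ^ 4)"
      unfolding F_def by (simp add: divide_simps) algebra
    moreover have "\<dots> > 0" using that by simp
    ultimately show ?thesis by linarith
  qed
  moreover have "(F \<longlongrightarrow> 0) at_top" unfolding F_def by real_asymp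
  ultimately have "hurwitz_zeta 3 p < F (real p)"
    using assms by (intro hurwitz_zeta_less) auto
  then show ?thesis by (simp add: F_def)
qed

text \<open>Up to \<open>1/x\<^sup>4\<close> the expansion overestimates \<open>\<zeta>(3,x)\<close>, and lowering the coefficient \<open>1/4\<close>
  enough to get a lower bound at \<open>p = 1\<close> would lose too much for large \<open>p\<close>. Hence the term
  \<open>1/(12x\<^sup>6)\<close>.\<close>

lemma hurwitz_zeta_3_greater:
  assumes "p > 0"
  shows "1 / (2 * real p ^ 2) + 1 / (2 * real p ^ 3) + 1 / (4 * real p ^ 4) - 1 / (12 * real p ^ 6)
    < hurwitz_zeta 3 p"
proof -
  define F :: "real \<Rightarrow> real" where
    "F = (\<lambda>x. 1 / (2 * x ^ 2) + 1 / (2 * x ^ 3) + 1 / (4 * x ^ 4) - 1 / (12 * x ^ 6))"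
  have "F x - F (x + 1) < 1 / x ^ 3" if "x \<ge> 1" for x
  proof -
    have "x \<noteq> 0" "x + 1 \<noteq> 0" using that by auto
    then have "1 / x ^ 3 - (F x - F (x + 1)) = (2 * x + 1) ^ 3 / (12 * x ^ 6 * (x + 1) ^ 6)"
      unfolding F_def by (simp add: divide_simps) algebra
    moreover have "\<dots> > 0" using that by simp
    ultimately show ?thesis by linarith
  qed
  moreover have "(F \<longlongrightarrow> 0) at_top" unfolding F_def by real_asymp
  ultimately have "F (real p) < hurwitz_zeta 3 p"
    using assms by (intro hurwitz_zeta_greater) auto
  then show ?thesis by (simp add: F_def)
qed

theorem theorem3:
  fixes p :: nat
  assumes "p > 0"
  shows "1 / real p - 1 / (2 * real p + 1) < Q p
       \<and> Q p < 1 / (2 * real p) + 3 / (8 * (real p)\<^sup>2)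
       \<and> 1 / (2 * real p) + 3 / (8 * (real p)\<^sup>2) < 1"
proof (intro conjI)
  define x where "x = real p"
  have x: "x \<ge> 1" using assms by (simp add: x_def)
  then have nz: "x \<noteq> 0" "2 * x + 1 \<noteq> 0" by auto
  have Q: "Q p = 2 * x ^ 2 * hurwitz_zeta 3 p - x * hurwitz_zeta 2 p"
    by (simp add: Q_def x_def)
  note bounds = hurwitz_zeta_2_less[OF assms] hurwitz_zeta_2_greater[OF assms]
    hurwitz_zeta_3_less[OF assms] hurwitz_zeta_3_greater[OF assms]
  note bounds = bounds[folded x_def]

  have "1 / x - 1 / (2 * x + 1) \<le> 1 / (2 * x) + 1 / (3 * x ^ 2) - 1 / (6 * x ^ 4)"
  proof -
    have "1 / (2 * x) + 1 / (3 * x ^ 2) - 1 / (6 * x ^ 4) - (1 / x - 1 / (2 * x + 1))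
        = (x - 1) * (x ^ 2 + 3 * x + 1) / (6 * x ^ 4 * (2 * x + 1))"
      using nz by (simp add: divide_simps) algebra
    moreover have "\<dots> \<ge> 0" using x by simp
    ultimately show ?thesis by linarith
  qed
  also have "\<dots> = 2 * x ^ 2 * (1 / (2 * x ^ 2) + 1 / (2 * x ^ 3) + 1 / (4 * x ^ 4) - 1 / (12 * x ^ 6))
      - x * (1 / x + 1 / (2 * x ^ 2) + 1 / (6 * x ^ 3))"
    using nz by (simp add: divide_simps) algebra
  also have "\<dots> < Q p"
    unfolding Q using bounds x by (intro diff_strict_mono mult_strict_left_mono) auto
  finally show "1 / real p - 1 / (2 * real p + 1) < Q p"
    by (simp add: x_def)

  have "Q p < 2 * x ^ 2 * (1 / (2 * x ^ 2) + 1 / (2 * x ^ 3) + 1 / (4 * x ^ 4))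
      - x * (1 / x + 1 / (2 * x ^ 2) + 1 / (8 * x ^ 3))"
    unfolding Q using bounds x by (intro diff_strict_mono mult_strict_left_mono) auto
  also have "\<dots> = 1 / (2 * x) + 3 / (8 * x ^ 2)"
    using nz by (simp add: divide_simps) algebra
  finally show "Q p < 1 / (2 * real p) + 3 / (8 * (real p)\<^sup>2)"
    by (simp add: x_def)

  have "1 / (2 * x) \<le> 1 / 2" using x by (simp add: divide_simps)
  moreover have "3 / (8 * x ^ 2) \<le> 3 / 8"
    using x by (simp add: divide_simps)
  ultimately have "1 / (2 * x) + 3 / (8 * x ^ 2) < 1" by linarith
  then show "1 / (2 * real p) + 3 / (8 * (real p)\<^sup>2) < 1" by (simp add: x_def)
qed

end
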